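(* Let $(X,\mathscr{B},\mu,T)$ be a measure preserving system. Suppose that for every $f \in L^{\infty}(X,\mu)$ with $\int_X f\,d\mu = 0$ there exists a set $A_f \subseteq X$ satisfying $\mu(A_f)=1$ such that for every $x\in A_f$ the sequence $\left(f(T^n x)\right)_{n=1}^{\infty}$ is a weakly mixing sequence. Then $T$ is weakly mixing.
   Context: A measure preserving system (m.p.s.) $(X,\mathscr{B},\mu,T)$ consists of a set $X$, a $\sigma$-algebra $\mathscr{B}$ of subsets of $X$, a probability measure $\mu$ on $(X,\mathscr{B})$ and a measurable transformation $T:X\to X$ with $\mu(A)=\mu(T^{-1}A)$ for all $A\in\mathscr{B}$. Functions are complex-valued and $\mathbb{N}=\{1,2,3,\dots\}$. $T$ (equivalently the m.p.s. $(X,\mathscr{B},\mu,T)$) is weakly mixing if for every $A,B\in\mathscr{B}$, $\lim_{N\to\infty}\frac1N\sum_{n=1}^N|\mu(A\cap T^{-n}B)-\mu(A)\mu(B)|=0$. Weakly mixing sequence: let $(x_n)_{n=1}^\infty\subseteq\mathbb{C}$ satisfy $\limsup_{N\to\infty}\frac1N\sum_{n=1}^N|x_n|<\infty$. Then $(x_n)_{n=1}^\infty$ is a weakly mixing sequence if the following holds: whenever $(y_n)_{n=1}^\infty\subseteq\mathbb{C}$ is a bounded sequence and $(N_q)_{q=1}^\infty\subseteq\mathbb{N}$ is a strictly increasing sequence such that $\ell(h):=\lim_{q\to\infty}\frac{1}{N_q}\sum_{n=1}^{N_q}x_{n+h}\overline{y_n}$ exists for every $h\in\mathbb{N}$, we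 have $\lim_{H\to\infty}\frac1H\sum_{h=1}^H|\ell(h)|=0$. *)

theory Defs
  imports "HOL-Probability.Probability"
begin

locale measure_preserving_system = prob_space M for M :: "'a measure" +
  fixes T :: "'a \<Rightarrow> 'a"
  assumes measurable_T: "T \<in> measurable M M"
    and measure_preserving: "\<And>A. A \<in> sets M \<Longrightarrow> emeasure M (T -` A \<inter> space M) = emeasure M A"

definition weakly_mixing :: "'a measure \<Rightarrow> ('a \<Rightarrow> 'a) \<Rightarrow> bool" where
  "weakly_mixing M T \<longleftrightarrow>
    (\<forall>A\<in>sets M. \<forall>B\<in>sets M.
      (\<lambda>N. (1 / real N) *
        (\<Sum>n=1..N. \<bar>measure M (A \<inter> ((T ^^ n) -` B \<inter> space M)) - measure M A * measure M B\<bar>))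
      \<longlonglongrightarrow> 0)"

text \<open>Representatives of the elements of \<open>L\<^sup>\<infinity>\<close>; functions equal almost everywhere are not identified.\<close>

definition Linfty :: "'a measure \<Rightarrow> ('a \<Rightarrow> complex) set" where
  "Linfty M = {f \<in> borel_measurable M. \<exists>C::real. AE x in M. cmod (f x) \<le> C}"

text \<open>
  Sequences are indexed by \<open>{1, 2, 3, \<dots>}\<close>; their values at \<open>0\<close> are irrelevant.
  For \<open>Nq\<close>, \<open>strict_mono\<close> implies \<open>Nq q \<ge> 1\<close> for all \<open>q \<ge> 1\<close>; conversely every strictly increasing
  sequence of positive integers indexed from \<open>1\<close> extends to a strictly monotone one by \<open>Nq 0 = 0\<close>.
\<close>

definition weakly_mixing_seq :: "(nat \<Rightarrow> complex) \<Rightarrow> bool" where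
  "weakly_mixing_seq x \<longleftrightarrow>
    limsup (\<lambda>N. ereal ((1 / real N) * (\<Sum>n=1..N. cmod (x n)))) < \<infinity> \<and>
    (\<forall>(y :: nat \<Rightarrow> complex) (Nq :: nat \<Rightarrow> nat) (l :: nat \<Rightarrow> complex).
      bounded (y ` {1..}) \<longrightarrow> strict_mono Nq \<longrightarrow>
      (\<forall>h\<ge>1. (\<lambda>q. (1 / of_nat (Nq q)) * (\<Sum>n=1..Nq q. x (n + h) * cnj (y n))) \<longlonglongrightarrow> l h) \<longrightarrow>
      (\<lambda>H. (1 / real H) * (\<Sum>h=1..H. cmod (l h))) \<longlonglongrightarrow> 0)"

end

theory Submission
  imports Defs "HOL-Library.Diagonal_Subsequence"
begin

text \<open>
  Let \<open>f = indicator B - \<mu>(B)\<close>, which has integral zero, and \<open>g = indicator A\<close>. The number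
  whose absolute value is averaged in the definition of weak mixing is the correlation \<open>\<integral> f(T\<^sup>h x) g(x) d\<mu>\<close>. By invariance of \<open>\<mu>\<close> it equals
  the integral of the ergodic average \<open>1/N \<Sum>n\<le>N. f(T\<^sup>n\<^sup>+\<^sup>h x) g(T\<^sup>n x)\<close>, for every \<open>N \<ge> 1\<close>; and this average is,
  when \<open>x\<close> is kept fixed, one of the averages that the notion of a weakly mixing sequence is about, for
  \<open>x\<^sub>n = f(T\<^sup>n x)\<close> and \<open>y\<^sub>n = g(T\<^sup>n x)\<close>. Suppose that along some \<open>N\<^sub>q\<close> these averages converge, for
  almost every \<open>x\<close> and all \<open>h\<close>, to \<open>\<ell>\<^sub>x(h)\<close>. The hypothesis gives \<open>1/H \<Sum>h\<le>H. \<bar>\<ell>\<^sub>x(h)\<bar> \<longlonglongrightarrow> 0\<close> almost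
  everywhere, and integration over \<open>x\<close> gives the claim, because the correlation at \<open>h\<close> is at most
  \<open>\<integral> \<bar>\<ell>\<^sub>x(h)\<bar> d\<mu>\<close> in absolute value.

  The definition of a weakly mixing sequence admits an arbitrary subsequence \<open>N\<^sub>q\<close>, so the pointwise
  ergodic theorem can be avoided: the mean ergodic theorem in the form "ergodic averages are
  Cauchy in \<open>L\<^sup>2\<close>" (\<open>ergodic_average_Cauchy_L2\<close>) suffices, since it yields an almost everywhere
  convergent subsequence, and a diagonal argument makes the subsequence independent of \<open>h\<close>
  (\<open>ergodic_averages_common_convergent_subseq\<close>). The Cauchy property follows from the parallelogram
  law applied to averages of almost minimal norm.
\<close>

section \<open>Ergodic averages\<close>

definition ergodic_average :: "('a \<Rightarrow> 'a) \<Rightarrow> ('a \<Rightarrow> real) \<Rightarrow> nat \<Rightarrow> 'a \<Rightarrow> real" where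
  "ergodic_average T u N x = (1 / real N) * (\<Sum>n=1..N. u ((T ^^ n) x))"

lemma abs_average_le:
  fixes a :: "nat \<Rightarrow> real"
  assumes "\<And>n. \<bar>a n\<bar> \<le> C"
  shows "\<bar>(1 / real N) * (\<Sum>n=1..N. a n)\<bar> \<le> C"
proof (cases "N = 0")
  case True
  have "0 \<le> C" using assms[of 0] by linarith
  with True show ?thesis by simp
next
  case False
  have "\<bar>\<Sum>n=1..N. a n\<bar> \<le> (\<Sum>n=1..N. C)"
    by (rule order_trans[OF sum_abs sum_mono]) (use assms in auto)
  then show ?thesis using False by (simp add: abs_mult field_simps)
qed

lemma abs_ergodic_average_le:
  assumes "\<And>x. \<bar>u x\<bar> \<le> C"
  shows "\<bar>ergodic_average T u N x\<bar> \<le> C"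
  unfolding ergodic_average_def by (rule abs_average_le) (rule assms)

lemma ergodic_average_mean:
  "ergodic_average T (\<lambda>x. (u x + v x) / 2) N x
     = (ergodic_average T u N x + ergodic_average T v N x) / 2"
  by (simp add: ergodic_average_def sum.distrib sum_divide_distrib[symmetric] add_divide_distrib)

lemma ergodic_average_power2_le:
  "(ergodic_average T u N x)\<^sup>2 \<le> ergodic_average T (\<lambda>x. (u x)\<^sup>2) N x"
proof (cases "N = 0")
  case False
  have "((\<Sum>n=1..N. u ((T ^^ n) x)) / real N)\<^sup>2 \<le> (\<Sum>n=1..N. (u ((T ^^ n) x))\<^sup>2) / real N"
    using sum_squared_le_sum_of_squares[of "\<lambda>n. u ((T ^^ n) x)" "{1..N}"] False
    by (simp add: power_divide field_simps power2_eq_square)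
  then show ?thesis by (simp add: ergodic_average_def)
qed (simp add: ergodic_average_def)

text \<open>Shifting a window of summation by one changes only its two end terms.\<close>

lemma abs_sum_shift_diff_le:
  fixes a :: "nat \<Rightarrow> real"
  assumes "\<And>n. \<bar>a n\<bar> \<le> C"
  shows "\<bar>(\<Sum>n=1..N. a (n + k)) - (\<Sum>n=1..N. a n)\<bar> \<le> 2 * C * real k"
proof (induction k)
  case (Suc k)
  have "(\<Sum>n=1..N. a (n + Suc k)) = (\<Sum>n=1..N. a (n + k)) + a (N + Suc k) - a (Suc k)"
    by (induction N) auto
  then have "\<bar>(\<Sum>n=1..N. a (n + Suc k)) - (\<Sum>n=1..N. a n)\<bar>
      \<le> \<bar>(\<Sum>n=1..N. a (n + k)) - (\<Sum>n=1..N. a n)\<bar> + \<bar>a (N + Suc k)\<bar> + \<bar>a (Suc k)\<bar>"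
    by linarith
  also have "\<dots> \<le> 2 * C * real k + C + C"
    using Suc assms by (intro add_mono) auto
  finally show ?case by (simp add: algebra_simps)
qed simp

text \<open>
  Averaging a function first does not affect its long averages: \<open>ergodic_average T (ergodic_average T u K) N\<close>
  is the mean over \<open>k \<le> K\<close> of the averages of \<open>u\<close> over windows of length \<open>N\<close> shifted by \<open>k\<close>.
\<close>

lemma ergodic_average_iterated_diff_le:
  assumes u: "\<And>x. \<bar>u x\<bar> \<le> C" and K: "K \<ge> 1"
  shows "\<bar>ergodic_average T (ergodic_average T u K) N x - ergodic_average T u N x\<bar>
           \<le> 2 * C * real K / real N"
proof (cases "N = 0")
  case False
  define a where "a n = u ((T ^^ n) x)" for n
  have orbit_shift: "u ((T ^^ k) ((T ^^ n) x)) = a (n + k)" for n k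
    by (simp add: a_def funpow_add add.commute[of n k])
  have C: "0 \<le> C" using u[of x] by linarith
  have "ergodic_average T (ergodic_average T u K) N x
      = (1 / real N) * (\<Sum>n=1..N. (1 / real K) * (\<Sum>k=1..K. a (n + k)))"
    unfolding ergodic_average_def by (simp only: orbit_shift)
  also have "\<dots> = (1 / real K) * (\<Sum>k=1..K. (1 / real N) * (\<Sum>n=1..N. a (n + k)))"
    unfolding sum_distrib_left by (subst sum.swap) (simp add: mult.commute)
  finally have "ergodic_average T (ergodic_average T u K) N x - ergodic_average T u N x
      = (1 / real K) * (\<Sum>k=1..K. (1 / real N) * (\<Sum>n=1..N. a (n + k)))
        - (1 / real K) * (\<Sum>k=1..K. (1 / real N) * (\<Sum>n=1..N. a n))"
    using K by (simp add: ergodic_average_def a_def)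
  also have "\<dots> = (1 / real K) *
      (\<Sum>k=1..K. (1 / real N) * ((\<Sum>n=1..N. a (n + k)) - (\<Sum>n=1..N. a n)))"
    unfolding right_diff_distrib sum_subtractf by simp
  finally have eq: "ergodic_average T (ergodic_average T u K) N x - ergodic_average T u N x = \<dots>" .
  have "\<bar>\<Sum>k=1..K. (1 / real N) * ((\<Sum>n=1..N. a (n + k)) - (\<Sum>n=1..N. a n))\<bar>
      \<le> (\<Sum>k=1..K. 2 * C * real K / real N)"
  proof (rule order_trans[OF sum_abs sum_mono])
    fix k assume k: "k \<in> {1..K}"
    have "\<bar>(\<Sum>n=1..N. a (n + k)) - (\<Sum>n=1..N. a n)\<bar> \<le> 2 * C * real k"
      by (rule abs_sum_shift_diff_le) (simp add: a_def u)
    also have "\<dots> \<le> 2 * C * real K" using k C by (intro mult_left_mono) auto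
    finally show "\<bar>1 / real N * ((\<Sum>n=1..N. a (n + k)) - (\<Sum>n=1..N. a n))\<bar> \<le> 2 * C * real K / real N"
      by (simp add: abs_mult divide_right_mono)
  qed
  then show ?thesis unfolding eq using K by (simp add: abs_mult field_simps)
qed (simp add: ergodic_average_def)

section \<open>Invariance of integrals\<close>

context measure_preserving_system
begin

lemma measurable_iterate [measurable]: "T ^^ n \<in> measurable M M"
proof (induction n)
  case (Suc n)
  then show ?case using measurable_compose[OF Suc measurable_T] by (simp add: o_def)
qed (simp add: id_def)

lemma distr_T: "distr M M T = M"
  by (rule measure_eqI) (simp_all add: emeasure_distr measurable_T measure_preserving)

lemma distr_iterate: "distr M M (T ^^ n) = M"
proof (induction n)
  case (Suc n)
  have "distr M M (T ^^ Suc n) = distr (distr M M (T ^^ n)) M T"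
    by (subst distr_distr) (simp_all add: measurable_T measurable_iterate)
  then show ?case by (simp only: Suc distr_T)
qed (simp add: id_def distr_id2)

lemma integral_iterate:
  fixes u :: "'a \<Rightarrow> real"
  assumes [measurable]: "u \<in> borel_measurable M"
  shows "(\<integral>x. u ((T ^^ n) x) \<partial>M) = (\<integral>x. u x \<partial>M)"
proof -
  have "(\<integral>x. u x \<partial>distr M M (T ^^ n)) = (\<integral>x. u ((T ^^ n) x) \<partial>M)"
    by (rule integral_distr) simp_all
  then show ?thesis by (simp add: distr_iterate)
qed

lemma borel_measurable_iterate [measurable]:
  fixes u :: "'a \<Rightarrow> real"
  assumes "u \<in> borel_measurable M"
  shows "(\<lambda>x. u ((T ^^ n) x)) \<in> borel_measurable M"
  by (rule measurable_compose[OF measurable_iterate assms])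

lemma borel_measurable_ergodic_average [measurable]:
  assumes [measurable]: "u \<in> borel_measurable M"
  shows "ergodic_average T u N \<in> borel_measurable M"
  unfolding ergodic_average_def[abs_def] by measurable

lemma integrable_bounded:
  fixes u :: "'a \<Rightarrow> real"
  assumes "u \<in> borel_measurable M" "\<And>x. \<bar>u x\<bar> \<le> C"
  shows "integrable M u"
  by (rule integrable_const_bound[of _ C]) (use assms in auto)

lemma integrable_power2_bounded:
  fixes u :: "'a \<Rightarrow> real"
  assumes [measurable]: "u \<in> borel_measurable M" and "\<And>x. \<bar>u x\<bar> \<le> C"
  shows "integrable M (\<lambda>x. (u x)\<^sup>2)"
  by (rule integrable_bounded[of _ "C\<^sup>2"]) (use assms power_mono[of "\<bar>u _\<bar>" C 2] in auto)

lemma integral_ergodic_average: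
  assumes [measurable]: "u \<in> borel_measurable M" and u: "\<And>x. \<bar>u x\<bar> \<le> C" and "N \<ge> 1"
  shows "(\<integral>x. ergodic_average T u N x \<partial>M) = (\<integral>x. u x \<partial>M)"
proof -
  have "integrable M (\<lambda>x. u ((T ^^ n) x))" for n
    by (rule integrable_bounded[of _ C]) (use u in auto)
  then show ?thesis
    using \<open>N \<ge> 1\<close> by (simp add: ergodic_average_def integral_iterate)
qed

lemma integral_ergodic_average_power2_le:
  assumes [measurable]: "u \<in> borel_measurable M" and u: "\<And>x. \<bar>u x\<bar> \<le> C" and "N \<ge> 1"
  shows "(\<integral>x. (ergodic_average T u N x)\<^sup>2 \<partial>M) \<le> (\<integral>x. (u x)\<^sup>2 \<partial>M)"
proof -
  have u2: "\<bar>(u x)\<^sup>2\<bar> \<le> C\<^sup>2" for x using power_mono[OF u, of x 2] by simp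
  have "(\<integral>x. (ergodic_average T u N x)\<^sup>2 \<partial>M) \<le> (\<integral>x. ergodic_average T (\<lambda>x. (u x)\<^sup>2) N x \<partial>M)"
    by (intro integral_mono ergodic_average_power2_le integrable_power2_bounded[of _ C]
        integrable_bounded[of _ "C\<^sup>2"] abs_ergodic_average_le u u2) measurable
  also have "\<dots> = (\<integral>x. (u x)\<^sup>2 \<partial>M)"
    by (rule integral_ergodic_average[OF _ u2 \<open>N \<ge> 1\<close>]) measurable
  finally show ?thesis .
qed

lemma integral_power2_perturb:
  fixes u v :: "'a \<Rightarrow> real"
  assumes [measurable]: "u \<in> borel_measurable M" "v \<in> borel_measurable M"
    and u: "\<And>x. \<bar>u x\<bar> \<le> C" and v: "\<And>x. \<bar>v x\<bar> \<le> C" and d: "\<And>x. \<bar>u x - v x\<bar> \<le> d"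
  shows "(\<integral>x. (u x)\<^sup>2 \<partial>M) \<le> (\<integral>x. (v x)\<^sup>2 \<partial>M) + 2 * C * d"
proof -
  have "(u x)\<^sup>2 \<le> (v x)\<^sup>2 + 2 * C * d" for x
  proof -
    have "(u x)\<^sup>2 - (v x)\<^sup>2 \<le> \<bar>u x + v x\<bar> * \<bar>u x - v x\<bar>"
      unfolding abs_mult[symmetric] square_diff_square_factored power2_eq_square by simp
    also have "\<dots> \<le> (2 * C) * d"
      using u[of x] v[of x] d[of x] by (intro mult_mono) linarith+
    finally show ?thesis by simp
  qed
  then have "(\<integral>x. (u x)\<^sup>2 \<partial>M) \<le> (\<integral>x. (v x)\<^sup>2 + 2 * C * d \<partial>M)"
    using integrable_power2_bounded[OF _ u] integrable_power2_bounded[OF _ v]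
    by (intro integral_mono) auto
  also have "\<dots> = (\<integral>x. (v x)\<^sup>2 \<partial>M) + 2 * C * d"
    using integrable_power2_bounded[OF _ v] by (subst Bochner_Integration.integral_add) (auto simp: prob_space)
  finally show ?thesis .
qed

section \<open>The mean ergodic theorem\<close>

text \<open>
  Averaging operators are \<open>L\<^sup>2\<close>-contractions, so \<open>w\<close> has at least the norm of its average of length
  \<open>L\<close>, which for large \<open>L\<close> is uniformly close to the average of \<open>u\<close>. Hence, although \<open>w\<close> is not an
  average of the same form, it obeys the same lower bound on the norm.
\<close>

lemma ergodic_average_mean_norm_ge:
  assumes [measurable]: "u \<in> borel_measurable M" and u: "\<And>x. \<bar>u x\<bar> \<le> C"
    and m: "\<And>L. L \<ge> 1 \<Longrightarrow> m \<le> (\<integral>x. (ergodic_average T u L x)\<^sup>2 \<partial>M)"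
    and "K \<ge> 1" "N \<ge> 1" "N' \<ge> 1"
  defines "v \<equiv> ergodic_average T u K"
  defines "w \<equiv> \<lambda>x. (ergodic_average T v N x + ergodic_average T v N' x) / 2"
  shows "m \<le> (\<integral>x. (w x)\<^sup>2 \<partial>M)"
proof -
  have v: "\<bar>v x\<bar> \<le> C" for x unfolding v_def by (rule abs_ergodic_average_le) (rule u)
  have [measurable]: "v \<in> borel_measurable M" unfolding v_def by measurable
  have [measurable]: "w \<in> borel_measurable M" unfolding w_def by measurable
  have w: "\<bar>w x\<bar> \<le> C" for x
    using abs_ergodic_average_le[of v C T N x, OF v] abs_ergodic_average_le[of v C T N' x, OF v]
    unfolding w_def by (auto simp: abs_le_iff)
  define R where "R = 2 * C * real K + 2 * C * real N + 2 * C * real N'"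
  have close: "\<bar>ergodic_average T u L x - ergodic_average T w L x\<bar> \<le> R / real L" for L x
  proof -
    let ?N = "ergodic_average T (ergodic_average T v N) L x"
    let ?N' = "ergodic_average T (ergodic_average T v N') L x"
    have eq: "ergodic_average T w L x = (?N + ?N') / 2"
      unfolding w_def by (rule ergodic_average_mean)
    have mean_diff_le: "\<bar>c - (a + b) / 2\<bar> \<le> \<delta> + \<delta>1 + \<delta>2"
      if "\<bar>a - d\<bar> \<le> \<delta>1" "\<bar>b - d\<bar> \<le> \<delta>2" "\<bar>d - c\<bar> \<le> \<delta>" for a b c d \<delta> \<delta>1 \<delta>2 :: real
      using that by argo
    have "\<bar>ergodic_average T u L x - ergodic_average T w L x\<bar>
        \<le> 2 * C * real K / real L + 2 * C * real N / real L + 2 * C * real N' / real L"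
      unfolding eq
    proof (rule mean_diff_le)
      show "\<bar>?N - ergodic_average T v L x\<bar> \<le> 2 * C * real N / real L"
        by (rule ergodic_average_iterated_diff_le) (use v \<open>N \<ge> 1\<close> in auto)
      show "\<bar>?N' - ergodic_average T v L x\<bar> \<le> 2 * C * real N' / real L"
        by (rule ergodic_average_iterated_diff_le) (use v \<open>N' \<ge> 1\<close> in auto)
      show "\<bar>ergodic_average T v L x - ergodic_average T u L x\<bar> \<le> 2 * C * real K / real L"
        unfolding v_def by (rule ergodic_average_iterated_diff_le) (use u \<open>K \<ge> 1\<close> in auto)
    qed
    then show ?thesis by (simp add: R_def add_divide_distrib)
  qed
  have bound: "m \<le> (\<integral>x. (w x)\<^sup>2 \<partial>M) + 2 * C * (R / real L)" if "L \<ge> 1" for L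
  proof -
    have "m \<le> (\<integral>x. (ergodic_average T u L x)\<^sup>2 \<partial>M)" by (rule m) fact
    also have "\<dots> \<le> (\<integral>x. (ergodic_average T w L x)\<^sup>2 \<partial>M) + 2 * C * (R / real L)"
      by (rule integral_power2_perturb) (auto intro!: abs_ergodic_average_le u w close)
    also have "(\<integral>x. (ergodic_average T w L x)\<^sup>2 \<partial>M) \<le> (\<integral>x. (w x)\<^sup>2 \<partial>M)"
      by (rule integral_ergodic_average_power2_le[OF _ w that]) measurable
    finally show ?thesis by simp
  qed
  have "(\<lambda>L. (\<integral>x. (w x)\<^sup>2 \<partial>M) + 2 * C * (R / real L)) \<longlonglongrightarrow> (\<integral>x. (w x)\<^sup>2 \<partial>M) + 2 * C * 0"
    by (intro tendsto_intros lim_const_over_n)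
  then have "m \<le> (\<integral>x. (w x)\<^sup>2 \<partial>M) + 2 * C * 0"
    by (rule LIMSEQ_le_const) (use bound in blast)
  then show ?thesis by simp
qed

text \<open>
  Let \<open>m\<close> be the infimum of the squared norms of the averages of \<open>u\<close>, almost attained by \<open>v\<close>. Two
  averages of \<open>v\<close> have at most the norm of \<open>v\<close>, and their mean has squared norm at least \<open>m\<close>; by the
  parallelogram law they are close. Long averages of \<open>u\<close> and \<open>v\<close> agree up to a small uniform error.
\<close>

theorem ergodic_average_Cauchy_L2:
  assumes [measurable]: "u \<in> borel_measurable M" and u: "\<And>x. \<bar>u x\<bar> \<le> C" and "e > 0"
  shows "\<exists>N0. \<forall>N\<ge>N0. \<forall>N'\<ge>N0.
    (\<integral>x. (ergodic_average T u N x - ergodic_average T u N' x)\<^sup>2 \<partial>M) < e"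
proof -
  define Q where "Q w = (\<integral>x. (w x)\<^sup>2 \<partial>M)" for w :: "'a \<Rightarrow> real"
  define m where "m = Inf ((\<lambda>L. Q (ergodic_average T u L)) ` {1..})"
  have bdd: "bdd_below ((\<lambda>L. Q (ergodic_average T u L)) ` {1..})"
    by (rule bdd_belowI[of _ 0]) (auto simp: Q_def)
  have m: "m \<le> (\<integral>x. (ergodic_average T u L x)\<^sup>2 \<partial>M)" if "L \<ge> 1" for L
    using that cInf_lower[OF _ bdd] unfolding m_def Q_def by auto
  have "m < m + e / 8" using \<open>e > 0\<close> by simp
  then obtain K where K: "K \<ge> 1" "Q (ergodic_average T u K) < m + e / 8"
    unfolding m_def by (subst (asm) (1) cInf_less_iff[OF _ bdd]) auto
  define v where "v = ergodic_average T u K"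
  have [measurable]: "v \<in> borel_measurable M" unfolding v_def by measurable
  have v: "\<bar>v x\<bar> \<le> C" for x unfolding v_def by (rule abs_ergodic_average_le) (rule u)
  have C: "0 \<le> C" using u[of undefined] by linarith
  let ?D = "\<lambda>w N N' x. ergodic_average T w N x - ergodic_average T w N' x"
  have near: "Q (?D v N N') < e / 2" if "N \<ge> 1" "N' \<ge> 1" for N N'
  proof -
    let ?w = "\<lambda>x. (ergodic_average T v N x + ergodic_average T v N' x) / 2"
    have int: "integrable M (\<lambda>x. (ergodic_average T v L x)\<^sup>2)" for L
      by (rule integrable_power2_bounded[of _ C]) (auto intro: abs_ergodic_average_le v)
    have w: "\<bar>?w x\<bar> \<le> C" for x
      using abs_ergodic_average_le[of v C T N x, OF v] abs_ergodic_average_le[of v C T N' x, OF v]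
      by (auto simp: abs_le_iff)
    have intw: "integrable M (\<lambda>x. (?w x)\<^sup>2)"
      by (rule integrable_power2_bounded[OF _ w]) measurable
    \<comment> \<open>the parallelogram law\<close>
    have "Q (?D v N N') = (\<integral>x. 2 * (ergodic_average T v N x)\<^sup>2 + 2 * (ergodic_average T v N' x)\<^sup>2
                             - 4 * (?w x)\<^sup>2 \<partial>M)"
      unfolding Q_def
      by (intro Bochner_Integration.integral_cong) (auto simp: power2_eq_square field_simps)
    also have "\<dots> = 2 * Q (ergodic_average T v N) + 2 * Q (ergodic_average T v N') - 4 * Q ?w"
      unfolding Q_def using int intw
      by (subst Bochner_Integration.integral_diff) (auto simp del: power_divide)
    also have "\<dots> \<le> 2 * Q v + 2 * Q v - 4 * m"
    proof -
      have "Q (ergodic_average T v N) \<le> Q v" "Q (ergodic_average T v N') \<le> Q v"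
        unfolding Q_def using that by (auto intro!: integral_ergodic_average_power2_le[OF _ v])
      moreover have "m \<le> Q ?w"
        unfolding Q_def v_def by (rule ergodic_average_mean_norm_ge[OF _ u m]) (use K that in auto)
      ultimately show ?thesis by linarith
    qed
    also have "\<dots> < e / 2" using K(2) unfolding v_def[symmetric] by linarith
    finally show ?thesis .
  qed
  have perturb: "Q (?D u N N') \<le> Q (?D v N N') + 4 * C * (2 * C * real K / real N + 2 * C * real K / real N')"
    for N N'
  proof -
    have D: "\<bar>?D w N N' x\<bar> \<le> 2 * C" if "\<And>x. \<bar>w x\<bar> \<le> C" for w x
      using abs_ergodic_average_le[of w C T N x, OF that] abs_ergodic_average_le[of w C T N' x, OF that]
      by linarith
    have "\<bar>?D u N N' x - ?D v N N' x\<bar> \<le> 2 * C * real K / real N + 2 * C * real K / real N'" for x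
      using ergodic_average_iterated_diff_le[of u C K T N x, OF u K(1)]
        ergodic_average_iterated_diff_le[of u C K T N' x, OF u K(1)]
      unfolding v_def by linarith
    then have "Q (?D u N N')
        \<le> Q (?D v N N') + 2 * (2 * C) * (2 * C * real K / real N + 2 * C * real K / real N')"
      unfolding Q_def by (intro integral_power2_perturb D u v) measurable
    then show ?thesis by simp
  qed
  \<comment> \<open>\<open>P / N\<close> is twice the contribution of \<open>N\<close> to the error term in \<open>perturb\<close>.\<close>
  define P where "P = 16 * C\<^sup>2 * real K"
  obtain N0 where N0: "real N0 > 2 * P / e" using reals_Archimedean2 by blast
  show ?thesis
  proof (intro exI[of _ "max 1 N0"] allI impI)
    fix N N' assume N: "max 1 N0 \<le> N" "max 1 N0 \<le> N'"
    have small: "P / real L < e / 2" if "max 1 N0 \<le> L" for L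
    proof -
      have "2 * P / e < real L" using that N0 by linarith
      then have "2 * P < real L * e" using \<open>e > 0\<close> by (simp add: divide_less_eq)
      then show ?thesis using that by (simp add: field_simps)
    qed
    have "4 * C * (2 * C * real K / real N + 2 * C * real K / real N')
        = (P / real N + P / real N') / 2"
      by (simp add: P_def power2_eq_square algebra_simps add_divide_distrib)
    also have "\<dots> < e / 2" using small[OF N(1)] small[OF N(2)] by simp
    finally have "Q (?D u N N') < Q (?D v N N') + e / 2"
      using perturb[of N N'] by linarith
    also have "\<dots> < e" using near[of N N'] N by simp
    finally show "(\<integral>x. (?D u N N' x)\<^sup>2 \<partial>M) < e" unfolding Q_def .
  qed
qed

lemma ergodic_average_Cauchy_L1:
  assumes [measurable]: "u \<in> borel_measurable M" and u: "\<And>x. \<bar>u x\<bar> \<le> C" and "e > 0"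
  shows "\<exists>N0. \<forall>N\<ge>N0. \<forall>N'\<ge>N0.
    (\<integral>x. \<bar>ergodic_average T u N x - ergodic_average T u N' x\<bar> \<partial>M) < e"
proof -
  let ?D = "\<lambda>N N' x. ergodic_average T u N x - ergodic_average T u N' x"
  have D: "\<bar>?D N N' x\<bar> \<le> 2 * C" for N N' x
    using abs_ergodic_average_le[of u C T N x, OF u] abs_ergodic_average_le[of u C T N' x, OF u]
    by linarith
  have L1_le: "(\<integral>x. \<bar>?D N N' x\<bar> \<partial>M) \<le> (\<integral>x. (?D N N' x)\<^sup>2 \<partial>M) / (2 * e) + e / 2" for N N'
  proof -
    \<comment> \<open>This bound, with the weight \<open>e\<close>, replaces the Cauchy-Schwarz inequality.\<close>
    have "\<bar>d\<bar> \<le> d\<^sup>2 / (2 * e) + e / 2" for d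
      using \<open>e > 0\<close> zero_le_power2[of "\<bar>d\<bar> - e"] by (simp add: field_simps power2_eq_square)
    moreover have int: "integrable M (\<lambda>x. (?D N N' x)\<^sup>2)"
      by (rule integrable_power2_bounded[OF _ D]) measurable
    moreover have "integrable M (\<lambda>x. \<bar>?D N N' x\<bar>)"
      by (rule integrable_bounded[of _ "2 * C"]) (use D in auto)
    ultimately have "(\<integral>x. \<bar>?D N N' x\<bar> \<partial>M) \<le> (\<integral>x. (?D N N' x)\<^sup>2 / (2 * e) + e / 2 \<partial>M)"
      by (intro integral_mono) auto
    also have "\<dots> = (\<integral>x. (?D N N' x)\<^sup>2 \<partial>M) / (2 * e) + e / 2"
      using int by (subst Bochner_Integration.integral_add) (auto simp: prob_space)
    finally show ?thesis .
  qed
  have "e\<^sup>2 > 0" using \<open>e > 0\<close> by simp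
  from ergodic_average_Cauchy_L2[OF assms(1) u this] obtain N0 where
    N0: "\<And>N N'. N \<ge> N0 \<Longrightarrow> N' \<ge> N0 \<Longrightarrow> (\<integral>x. (?D N N' x)\<^sup>2 \<partial>M) < e\<^sup>2" by auto
  show ?thesis
  proof (intro exI[of _ N0] allI impI)
    fix N N' assume "N0 \<le> N" "N0 \<le> N'"
    then have "(\<integral>x. (?D N N' x)\<^sup>2 \<partial>M) / (2 * e) < e / 2"
      using N0[of N N'] \<open>e > 0\<close> by (simp add: field_simps power2_eq_square)
    then show "(\<integral>x. \<bar>?D N N' x\<bar> \<partial>M) < e" using L1_le[of N N'] by linarith
  qed
qed

text \<open>
  Each Cauchy sequence in \<open>L\<^sup>1\<close> has an almost everywhere convergent subsequence, and countably many
  such extractions can be diagonalised.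
\<close>

lemma ergodic_averages_common_convergent_subseq:
  fixes u :: "nat \<Rightarrow> 'a \<Rightarrow> real"
  assumes [measurable]: "\<And>h. u h \<in> borel_measurable M" and u: "\<And>h x. \<bar>u h x\<bar> \<le> C"
  obtains r :: "nat \<Rightarrow> nat" where "strict_mono r"
    "AE x in M. \<forall>h. convergent (\<lambda>q. ergodic_average T (u h) (r q) x)"
proof -
  define P where "P h s \<longleftrightarrow> (AE x in M. Cauchy (\<lambda>q. ergodic_average T (u h) (s q) x))"
    for h and s :: "nat \<Rightarrow> nat"
  interpret subseqs P
  proof
    fix h and s :: "nat \<Rightarrow> nat" assume s: "strict_mono s"
    have "integrable M (ergodic_average T (u h) (s n))" for n
      by (rule integrable_bounded[of _ C]) (auto intro: abs_ergodic_average_le u)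
    moreover have "\<exists>N. \<forall>i\<ge>N. \<forall>j\<ge>N.
        (\<integral>x. norm (ergodic_average T (u h) (s i) x - ergodic_average T (u h) (s j) x) \<partial>M) < e"
      if "e > 0" for e
    proof -
      from ergodic_average_Cauchy_L1[OF assms(1) u that, of h] obtain N0 where N0: "\<And>N N'. N \<ge> N0 \<Longrightarrow> N' \<ge> N0 \<Longrightarrow>
          (\<integral>x. \<bar>ergodic_average T (u h) N x - ergodic_average T (u h) N' x\<bar> \<partial>M) < e" by auto
      have "s i \<ge> N0" if "i \<ge> N0" for i using seq_suble[OF s, of i] that by linarith
      then show ?thesis using N0 by (auto intro!: exI[of _ N0])
    qed
    ultimately obtain r where "strict_mono r"
        "AE x in M. Cauchy (\<lambda>i. ergodic_average T (u h) (s (r i)) x)"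
      by (rule cauchy_L1_AE_cauchy_subseq)
    then show "\<exists>r'. strict_mono r' \<and> P h (s \<circ> r')" unfolding P_def o_def by blast
  qed
  have "AE x in M. convergent (\<lambda>q. ergodic_average T (u h) (diagseq q) x)" for h
  proof -
    \<comment> \<open>Only from its index \<open>Suc h\<close> on is the diagonal sequence a subsequence of the one chosen for \<open>h\<close>.\<close>
    have "P h (diagseq \<circ> (+) (Suc h))"
    proof (rule diagseq_holds)
      fix r s :: "nat \<Rightarrow> nat" and n :: nat assume "strict_mono r" "P n s"
      then show "P n (s \<circ> r)"
        unfolding P_def by (auto elim!: eventually_mono dest: Cauchy_subseq_Cauchy simp: o_def)
    qed
    then have "AE x in M. Cauchy (\<lambda>q. ergodic_average T (u h) (diagseq (q + Suc h)) x)"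
      by (simp add: P_def add.commute)
    then show ?thesis
    proof eventually_elim
      case (elim x)
      then show ?case
        using convergent_ignore_initial_segment[of "\<lambda>q. ergodic_average T (u h) (diagseq q) x" "Suc h"]
        by (simp add: Cauchy_convergent_iff)
    qed
  qed
  then have "AE x in M. \<forall>h. convergent (\<lambda>q. ergodic_average T (u h) (diagseq q) x)"
    by (simp add: AE_all_countable)
  with subseq_diagseq show thesis by (rule that)
qed

section \<open>From weakly mixing orbits to decay of correlations\<close>

text \<open>
  The weak mixing of an orbit is tested against \<open>y\<^sub>n = g(T\<^sup>n x)\<close>. The limit functions \<open>l h\<close> are all
  bounded by \<open>1\<close>, so dominated convergence carries the averages to the limit twice: in the length of
  the ergodic averages, to compare the correlations with the integrals of \<open>\<bar>l h\<bar>\<close>, and then in \<open>H\<close>.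
\<close>

lemma weakly_mixing_orbits_imp_correlations_tendsto_0:
  fixes f g :: "'a \<Rightarrow> real"
  assumes [measurable]: "f \<in> borel_measurable M" "g \<in> borel_measurable M"
    and f: "\<And>x. \<bar>f x\<bar> \<le> 1" and g: "\<And>x. \<bar>g x\<bar> \<le> 1"
    and wm: "AE x in M. weakly_mixing_seq (\<lambda>n. complex_of_real (f ((T ^^ n) x)))"
  shows "(\<lambda>H. (1 / real H) * (\<Sum>h=1..H. \<bar>\<integral>x. f ((T ^^ h) x) * g x \<partial>M\<bar>)) \<longlonglongrightarrow> 0"
proof -
  define u where "u h x = f ((T ^^ h) x) * g x" for h x
  have [measurable]: "u h \<in> borel_measurable M" for h unfolding u_def by measurable
  have u: "\<bar>u h x\<bar> \<le> 1" for h x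
    using mult_mono[OF f[of "(T ^^ h) x"] g[of x]] by (simp add: u_def abs_mult)
  obtain r where r: "strict_mono r"
    and conv: "AE x in M. \<forall>h. convergent (\<lambda>q. ergodic_average T (u h) (r q) x)"
    using ergodic_averages_common_convergent_subseq[of u 1] u by auto
  define l where "l h x = lim (\<lambda>q. ergodic_average T (u h) (r q) x)" for h x
  have [measurable]: "l h \<in> borel_measurable M" for h
    unfolding l_def by measurable
  have l: "AE x in M. \<forall>h. (\<lambda>q. ergodic_average T (u h) (r q) x) \<longlonglongrightarrow> l h x"
    using conv by eventually_elim (simp add: l_def convergent_LIMSEQ_iff)
  have l_bound: "AE x in M. \<forall>h. \<bar>l h x\<bar> \<le> 1"
    using l
  proof eventually_elim
    fix x assume lim: "\<forall>h. (\<lambda>q. ergodic_average T (u h) (r q) x) \<longlonglongrightarrow> l h x"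
    show "\<forall>h. \<bar>l h x\<bar> \<le> 1"
    proof
      fix h
      show "\<bar>l h x\<bar> \<le> 1"
        by (rule tendsto_upperbound[OF tendsto_rabs[OF lim[rule_format, of h]]])
          (auto intro!: always_eventually abs_ergodic_average_le u)
    qed
  qed
  have l_int: "integrable M (\<lambda>x. \<bar>l h x\<bar>)" for h
    by (rule integrable_const_bound[of _ 1]) (use l_bound in auto)
  have correlation_le: "\<bar>\<integral>x. u h x \<partial>M\<bar> \<le> (\<integral>x. \<bar>l h x\<bar> \<partial>M)" for h
  proof -
    have "(\<lambda>q. \<integral>x. ergodic_average T (u h) (r q) x \<partial>M) \<longlonglongrightarrow> (\<integral>x. l h x \<partial>M)"
      by (rule integral_dominated_convergence[where w = "\<lambda>_. 1"])
        (use l in \<open>auto intro!: abs_ergodic_average_le u\<close>)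
    moreover have "(\<integral>x. ergodic_average T (u h) (r q) x \<partial>M) = (\<integral>x. u h x \<partial>M)" if "q \<ge> 1" for q
    proof -
      have "r q \<ge> 1" using seq_suble[OF r, of q] that by linarith
      then show ?thesis by (intro integral_ergodic_average[OF _ u]) auto
    qed
    then have "(\<lambda>q. \<integral>x. ergodic_average T (u h) (r q) x \<partial>M) \<longlonglongrightarrow> (\<integral>x. u h x \<partial>M)"
      by (intro tendsto_eventually eventually_sequentiallyI[of 1])
    ultimately have "(\<integral>x. u h x \<partial>M) = (\<integral>x. l h x \<partial>M)" by (rule LIMSEQ_unique[symmetric])
    then show ?thesis by simp
  qed
  have "AE x in M. (\<lambda>H. (1 / real H) * (\<Sum>h=1..H. \<bar>l h x\<bar>)) \<longlonglongrightarrow> 0"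
    using l wm
  proof eventually_elim
    fix x assume lim: "\<forall>h. (\<lambda>q. ergodic_average T (u h) (r q) x) \<longlonglongrightarrow> l h x"
      and wm_x: "weakly_mixing_seq (\<lambda>n. complex_of_real (f ((T ^^ n) x)))"
    let ?y = "\<lambda>n. complex_of_real (g ((T ^^ n) x))"
    have bounded_y: "bounded (?y ` {1..})"
      by (rule boundedI[of _ 1]) (use g in auto)
    have lim_y: "(\<lambda>q. (1 / of_nat (r q)) *
        (\<Sum>n=1..r q. complex_of_real (f ((T ^^ (n + h)) x)) * cnj (?y n))) \<longlonglongrightarrow> complex_of_real (l h x)" for h
    proof -
      have "f ((T ^^ (n + h)) x) * g ((T ^^ n) x) = u h ((T ^^ n) x)" for n
        unfolding u_def by (simp add: funpow_add add.commute[of n h])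
      then have "(1 / of_nat (r q)) *
          (\<Sum>n=1..r q. complex_of_real (f ((T ^^ (n + h)) x)) * cnj (?y n))
          = complex_of_real (ergodic_average T (u h) (r q) x)" for q
        unfolding ergodic_average_def by (simp flip: of_real_mult of_real_sum)
      then show ?thesis using lim by (auto intro: tendsto_of_real)
    qed
    have "(\<lambda>H. (1 / real H) * (\<Sum>h=1..H. cmod (complex_of_real (l h x)))) \<longlonglongrightarrow> 0"
      by (intro wm_x[unfolded weakly_mixing_seq_def, THEN conjunct2, rule_format, of ?y r]
          bounded_y r lim_y)
    then show "(\<lambda>H. (1 / real H) * (\<Sum>h=1..H. \<bar>l h x\<bar>)) \<longlonglongrightarrow> 0" by simp
  qed
  then have "(\<lambda>H. \<integral>x. (1 / real H) * (\<Sum>h=1..H. \<bar>l h x\<bar>) \<partial>M) \<longlonglongrightarrow> (\<integral>x. 0 \<partial>M)"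
  proof (rule integral_dominated_convergence[where w = "\<lambda>_. 1", rotated 3])
    show "AE x in M. norm ((1 / real H) * (\<Sum>h=1..H. \<bar>l h x\<bar>)) \<le> 1" for H
      using l_bound
    proof eventually_elim
      fix x assume "\<forall>h. \<bar>l h x\<bar> \<le> 1"
      then show "norm ((1 / real H) * (\<Sum>h=1..H. \<bar>l h x\<bar>)) \<le> 1"
        unfolding real_norm_def by (intro abs_average_le) simp
    qed
  qed auto
  then have "(\<lambda>H. (1 / real H) * (\<Sum>h=1..H. \<integral>x. \<bar>l h x\<bar> \<partial>M)) \<longlonglongrightarrow> 0"
    using l_int by simp
  then have "(\<lambda>H. (1 / real H) * (\<Sum>h=1..H. \<bar>\<integral>x. u h x \<partial>M\<bar>)) \<longlonglongrightarrow> 0"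
    by (rule tendsto_sandwich[OF _ _ tendsto_const, rotated 2])
      (auto intro!: always_eventually mult_left_mono sum_mono correlation_le sum_nonneg
        divide_right_mono)
  then show ?thesis by (simp add: u_def)
qed

lemma correlation_centered_indicator:
  assumes [measurable]: "A \<in> sets M" "B \<in> sets M"
  shows "(\<integral>x. (indicator B ((T ^^ n) x) - measure M B) * indicator A x \<partial>M)
    = measure M (A \<inter> ((T ^^ n) -` B \<inter> space M)) - measure M A * measure M B"
proof -
  let ?E = "A \<inter> ((T ^^ n) -` B \<inter> space M)"
  have [measurable]: "?E \<in> sets M" by measurable
  have "(\<integral>x. (indicator B ((T ^^ n) x) - measure M B) * indicator A x \<partial>M)
      = (\<integral>x. indicator ?E x - measure M B * indicator A x \<partial>M)"
    by (intro Bochner_Integration.integral_cong) (auto simp: indicator_def)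
  also have "\<dots> = measure M ?E - measure M B * measure M A"
    by (subst Bochner_Integration.integral_diff) (auto simp: emeasure_eq_measure)
  finally show ?thesis by (simp add: mult.commute)
qed

end

theorem proposition1p12:
  fixes M :: "'a measure" and T :: "'a \<Rightarrow> 'a"
  assumes "measure_preserving_system M T"
    and "\<And>f. f \<in> Linfty M \<Longrightarrow> (\<integral>x. f x \<partial>M) = 0 \<Longrightarrow>
           \<exists>A\<in>sets M. measure M A = 1 \<and> (\<forall>x\<in>A. weakly_mixing_seq (\<lambda>n. f ((T ^^ n) x)))"
  shows "weakly_mixing M T"
  unfolding weakly_mixing_def
proof (intro ballI)
  fix A B assume [measurable]: "A \<in> sets M" "B \<in> sets M"
  interpret measure_preserving_system M T by fact
  define f where "f x = indicator B x - measure M B" for x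
  have [measurable]: "f \<in> borel_measurable M" unfolding f_def by measurable
  have f: "\<bar>f x\<bar> \<le> 1" for x
    using measure_nonneg[of M B] prob_le_1[of B]
    by (cases "x \<in> B") (simp_all add: f_def)
  have "(\<integral>x. f x \<partial>M) = 0"
    unfolding f_def
    by (subst Bochner_Integration.integral_diff) (auto simp: emeasure_eq_measure prob_space)
  then have "(\<integral>x. complex_of_real (f x) \<partial>M) = 0" by simp
  moreover have "(\<lambda>x. complex_of_real (f x)) \<in> Linfty M"
    unfolding Linfty_def using f by (auto intro!: exI[of _ 1])
  ultimately obtain S where "measure M S = 1"
      "\<forall>x\<in>S. weakly_mixing_seq (\<lambda>n. complex_of_real (f ((T ^^ n) x)))"
    using assms(2) by blast
  then have "AE x in M. weakly_mixing_seq (\<lambda>n. complex_of_real (f ((T ^^ n) x)))"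
    using AE_prob_1[of S] by (auto elim: eventually_mono)
  then have "(\<lambda>N. (1 / real N) * (\<Sum>n=1..N. \<bar>\<integral>x. f ((T ^^ n) x) * indicator A x \<partial>M\<bar>)) \<longlonglongrightarrow> 0"
    by (intro weakly_mixing_orbits_imp_correlations_tendsto_0 f) (auto simp: indicator_def)
  then show "(\<lambda>N. (1 / real N) *
      (\<Sum>n=1..N. \<bar>measure M (A \<inter> ((T ^^ n) -` B \<inter> space M)) - measure M A * measure M B\<bar>)) \<longlonglongrightarrow> 0"
    unfolding f_def by (simp only: correlation_centered_indicator \<open>A \<in> sets M\<close> \<open>B \<in> sets M\<close>)
qed

end
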